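(* Let $(R_j)_{j\ge 0}$ be any sequence in $\{0,1\}$ with $R_0=1$ (a prescribed right half). Then there is exactly one sequence $(L_j)_{j\ge 1}$ in $\{0,1\}$ (left half) such that the configuration $x\in\{0,1\}^{\mathbb Z}$ defined by $x_j=R_j$ for $j\ge 0$ and $x_{-j}=L_j$ for $j\ge 1$ has identically one central trace, i.e. $F^t(x)_0=1$ for all $t\ge 0$. This left half is the same for every such right half: for all $j\ge 1$, $L_j=1$ if and only if $j$ is even.
   Context: Rule 30 is the map $F:\{0,1\}^{\mathbb Z}\to\{0,1\}^{\mathbb Z}$ given by $F(x)_i=x_{i-1}\oplus(x_i\lor x_{i+1})$, where $\oplus$ is addition modulo $2$ and $\lor$ is Boolean disjunction. $F^t$ is the $t$-fold iterate, with $F^0(x)=x$. The central trace of a configuration $x$ is the sequence $(F^t(x)_0)_{t\ge 0}$. *)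

theory Defs
  imports "HOL-Library.Z2" "HOL-Library.FuncSet"
begin

text \<open>On \<^typ>\<open>bit\<close>, addition is addition modulo 2 and \<open>OR\<close> is Boolean disjunction.\<close>

unbundle bit_operations_syntax

type_synonym configuration = "int \<Rightarrow> bit"

definition rule30 :: "configuration \<Rightarrow> configuration" where
  "rule30 x = (\<lambda>i. x (i - 1) + (x i OR x (i + 1)))"

definition central_trace :: "configuration \<Rightarrow> nat \<Rightarrow> bit" where
  "central_trace x = (\<lambda>t. (rule30 ^^ t) x 0)"

text \<open>
  A left half is a sequence indexed by \<open>j \<ge> 1\<close>, encoded as a function on \<^typ>\<open>nat\<close>
  that is \<^term>\<open>undefined\<close> at \<open>0\<close>, so that equality of functions is equality of sequences.
\<close>

definition left_halves :: "(nat \<Rightarrow> bit) set" where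
  "left_halves = {1..} \<rightarrow>\<^sub>E UNIV"

definition glue :: "(nat \<Rightarrow> bit) \<Rightarrow> (nat \<Rightarrow> bit) \<Rightarrow> configuration" where
  "glue L R = (\<lambda>i. if i \<ge> 0 then R (nat i) else L (nat (- i)))"

end

theory Submission
  imports Defs
begin

text \<open>
  Rule 30 is left-permutive: the cell \<open>x (i - 1)\<close> is determined by the cells \<open>x i\<close> and
  \<open>x (i + 1)\<close> together with the new value at \<open>i\<close>.  Hence two neighbouring space-time columns
  determine the column to their left, and a constant one in column \<open>0\<close> propagates leftwards.
  A column of ones forces zeros in the column to its left whatever stands to its right, because
  a disjunction with one is one; this is why the right half is irrelevant.  A column of zeros with
  ones to its right forces ones to its left.  So all columns on the left are constant and alternate
  (\<open>column_of_constant_trace\<close>), which at time \<open>0\<close> is uniqueness.  Conversely, the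
  alternating left half reproduces itself under the rule, again for any right half
  (\<open>rule30_alternating\<close>), which is existence.
\<close>

definition alternating :: "configuration \<Rightarrow> bool" where
  "alternating x \<longleftrightarrow> (\<forall>j. x (- int j) = of_bool (even j))"

lemma one_or_bit: "(1 :: bit) OR b = 1"
  by (cases b) simp_all

text \<open>Left-permutivity; addition on \<^typ>\<open>bit\<close> is its own inverse.\<close>

lemma rule30_left_permutive: "x (i - 1) = rule30 x i + (x i OR x (i + 1))"
  by (cases "x (i - 1)"; cases "x i"; cases "x (i + 1)") (simp_all add: rule30_def)

text \<open>
  At even \<open>j\<close> the cell itself makes the disjunction one; only there can the disjunction reach
  into the right half (at \<open>j = 0\<close>).  At odd \<open>j\<close> the right neighbour, which still lies in the
  alternating part, makes it one.
\<close>

lemma rule30_alternating: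
  assumes "alternating x"
  shows "alternating (rule30 x)"
  unfolding alternating_def
proof
  fix j
  have left: "x (- int j - 1) = of_bool (odd j)"
  proof -
    have "x (- int (Suc j)) = of_bool (even (Suc j))"
      using assms unfolding alternating_def by blast
    moreover have "- int (Suc j) = - int j - 1" by simp
    ultimately show ?thesis by (simp only: even_Suc)
  qed
  have here: "x (- int j) = of_bool (even j)"
    using assms by (simp add: alternating_def)
  have "x (- int j) OR x (- int j + 1) = 1"
  proof (cases "even j")
    case True
    then show ?thesis by (simp add: here one_or_bit)
  next
    case False
    then obtain k where "j = Suc k" "even k" by (cases j) auto
    moreover have "x (- int k) = of_bool (even k)"
      using assms by (simp add: alternating_def)
    ultimately show ?thesis by (simp add: here)
  qed
  with left show "rule30 x (- int j) = of_bool (even j)"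
    by (simp add: rule30_def)
qed

lemma alternating_trace:
  assumes "alternating x"
  shows "central_trace x t = 1"
proof -
  have "alternating ((rule30 ^^ t) x)"
    using assms by (induction t) (simp_all add: rule30_alternating)
  then have "(rule30 ^^ t) x (- int 0) = of_bool (even (0 :: nat))"
    unfolding alternating_def by blast
  then show ?thesis by (simp add: central_trace_def)
qed

text \<open>
  The claim is about all times at once, since reading off a column from its right neighbours by
  left-permutivity uses the values one time step later.
\<close>

lemma column_of_constant_trace:
  assumes "\<And>t. central_trace x t = 1"
  shows "(rule30 ^^ t) x (- int j) = of_bool (even j)"
proof (induction j arbitrary: t rule: less_induct)
  case (less j)
  show ?case
  proof (cases j)
    case 0
    then show ?thesis using assms[of t] by (simp add: central_trace_def)
  next
    case (Suc k)
    let ?y = "(rule30 ^^ t) x"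
    have now: "?y (- int k) = of_bool (even k)"
      and later: "rule30 ?y (- int k) = of_bool (even k)"
      using less[of k t] less[of k "Suc t"] Suc by simp_all
    have "?y (- int k) OR ?y (- int k + 1) = 1"
    proof (cases "even k")
      case True
      then show ?thesis by (simp add: now one_or_bit)
    next
      case False
      then obtain m where "k = Suc m" "even m" by (cases k) auto
      then show ?thesis using less[of m t] Suc now by simp
    qed
    then have "?y (- int k - 1) = of_bool (even k) + 1"
      using rule30_left_permutive[of ?y "- int k"] later by simp
    moreover have "- int k - 1 = - int j" using Suc by simp
    ultimately show ?thesis using Suc by simp
  qed
qed

lemma constant_trace_iff_alternating:
  "(\<forall>t. central_trace x t = 1) \<longleftrightarrow> alternating x"
proof
  assume "\<forall>t. central_trace x t = 1"
  then show "alternating x"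
    using column_of_constant_trace[of x 0] by (simp add: alternating_def)
qed (simp add: alternating_trace)

lemma alternating_glue_iff:
  assumes "R 0 = 1"
  shows "alternating (glue L R) \<longleftrightarrow> (\<forall>j\<ge>1. L j = of_bool (even j))"
proof -
  have "glue L R (- int j) = (if j = 0 then 1 else L j)" for j
    using assms by (simp add: glue_def)
  then show ?thesis
    unfolding alternating_def by (auto simp: Suc_le_eq)
qed

theorem theorem3:
  fixes R :: "nat \<Rightarrow> bit"
  assumes "R 0 = 1"
  shows "(\<exists>!L. L \<in> left_halves \<and> (\<forall>t. central_trace (glue L R) t = 1))
    \<and> (\<forall>L \<in> left_halves. (\<forall>t. central_trace (glue L R) t = 1)
          \<longrightarrow> (\<forall>j\<ge>1. L j = 1 \<longleftrightarrow> even j))"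
proof -
  have trace_iff: "(\<forall>t. central_trace (glue L R) t = 1) \<longleftrightarrow> (\<forall>j\<ge>1. L j = of_bool (even j))" for L
    using assms by (simp add: constant_trace_iff_alternating alternating_glue_iff)
  have "\<exists>!L. L \<in> left_halves \<and> (\<forall>j\<ge>1. L j = of_bool (even j))"
  proof (rule ex1I)
    let ?A = "restrict (\<lambda>j. of_bool (even j)) {1..} :: nat \<Rightarrow> bit"
    show "?A \<in> left_halves \<and> (\<forall>j\<ge>1. ?A j = of_bool (even j))"
      by (auto simp: left_halves_def)
    show "L = ?A" if "L \<in> left_halves \<and> (\<forall>j\<ge>1. L j = of_bool (even j))" for L
      using that unfolding left_halves_def
      by (intro extensionalityI[of _ "{1..}"]) (auto simp: PiE_def)
  qed
  then show ?thesis
    unfolding trace_iff by simp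
qed

end
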